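(* Let $\mathbf{B}\in\mathbb{C}^{n\times n}$ be decomposed as $\mathbf{B}=\mathbf{U}\,\mathrm{diag}\{\boldsymbol{\sigma}(\mathbf{B})\}\,\mathbf{V}^{*}$ where $\mathbf{U},\mathbf{V}\in\mathbb{C}^{n\times n}$ satisfy $\mathbf{U}\mathbf{U}^{*}=\mathbf{I}=\mathbf{V}\mathbf{V}^{*}$ and $\boldsymbol{\sigma}(\mathbf{B})=(\sigma_\ell(\mathbf{B}))_{0\le\ell<n}\subset\mathbb{C}$ with $\sigma_{\ell}(\mathbf{B})=|\sigma_{\ell}(\mathbf{B})|e^{i\theta_{\ell}}$ for $\theta_{\ell}\in\{0,\pi\}$. Let $\mathbf{f},\mathbf{g}\in\mathbb{C}^{n\times1}$ be such that there exist $\mathbf{F},\mathbf{G}\in\mathbb{C}^{n\times1}$ satisfying $\mathbf{F}\circ\mathbf{G}\ne\mathbf{0}_{n\times1}$ and $$\mathbf{f}=\mathbf{U}\overline{\mathbf{F}},\qquad \mathbf{g}=\mathbf{V}\mathbf{G},\qquad \text{and for all } 0\le\ell<n,\ \ \mathbf{F}[\ell]\,\mathbf{G}[\ell]\,e^{i\theta_{\ell}}\in\mathbb{R}.$$ Then $$\min_{0\le\ell<n}\left\{|\sigma_{\ell}(\mathbf{B})|\,\mathrm{sgn}\!\left(\mathbf{F}[\ell]\mathbf{G}[\ell]e^{i\theta_{\ell}}\right)\right\}\le\frac{\mathbf{f}^{*}\mathbf{B}\mathbf{g}}{\sum_{0\le\ell<n}\left|\mathbf{F}[\ell]\mathbf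{G}[\ell]\right|}\le\max_{0\le\ell<n}\left\{|\sigma_{\ell}(\mathbf{B})|\,\mathrm{sgn}\!\left(\mathbf{F}[\ell]\mathbf{G}[\ell]e^{i\theta_{\ell}}\right)\right\}.$$
   Context: Indices of vectors and matrices run over $0,\dots,n-1$; $\mathbf{F}[\ell]$ is the $\ell$-th entry of $\mathbf{F}$. $\mathbf{A}^{*}$ is the conjugate transpose of $\mathbf{A}$, $\overline{\mathbf{F}}$ is the entrywise complex conjugate, $\mathbf{I}$ is the identity matrix, $\mathrm{diag}\{\boldsymbol{\sigma}\}$ is the diagonal matrix with $\ell$-th diagonal entry $\sigma_\ell$, $\mathbf{0}_{n\times 1}$ is the zero vector, and $\circ$ is the Hadamard (entrywise) product. $\mathrm{sgn}$ is the sign of a real number, with $\mathrm{sgn}(0)=0$. The decomposition is a singular value decomposition up to signs of the singular values: the $\sigma_\ell(\mathbf{B})$ are allowed to be negative. *)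

theory Defs
  imports Complex_Main "Jordan_Normal_Form.Schur_Decomposition"
begin

definition hadamard_vec :: "'a :: times vec \<Rightarrow> 'a vec \<Rightarrow> 'a vec" where
  "hadamard_vec u v = vec (dim_vec u) (\<lambda>l. u $ l * v $ l)"

end

theory Submission
  imports Defs
begin

text \<open>
  Moving \<open>U\<close> to the other side of the inner product and cancelling \<open>U\<^sup>* U = 1\<close> and
  \<open>V\<^sup>* V = 1\<close> turns the form \<open>f\<^sup>* B g\<close> into the diagonal sum of \<open>F\<^sub>l \<sigma>\<^sub>l G\<^sub>l\<close>; the conjugate in
  \<open>f = U (conjugate F)\<close> is there so that \<open>F\<close> itself, not its conjugate, appears in this sum
  (\<open>sesquilinear_form_svd\<close>). Writing \<open>\<sigma>\<^sub>l = |\<sigma>\<^sub>l| u\<^sub>l\<close> with the phase \<open>u\<^sub>l = exp (i \<theta>\<^sub>l)\<close>,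
  the remaining factor \<open>F\<^sub>l G\<^sub>l u\<^sub>l\<close> is real and
  has the modulus of \<open>F\<^sub>l G\<^sub>l\<close>, so it equals \<open>|F\<^sub>l G\<^sub>l|\<close> times its sign. Hence the quotient in the
  theorem is the average of the signed values \<open>|\<sigma>\<^sub>l| sgn (F\<^sub>l G\<^sub>l u\<^sub>l)\<close> with the nonnegative weights
  \<open>|F\<^sub>l G\<^sub>l|\<close>, and an average lies between the smallest and the largest of its values
  (\<open>weighted_average_bounds\<close>). The weights have positive sum because \<open>F\<close> and \<open>G\<close> have a common
  nonzero entry.
\<close>

lemma mat_adjoint_carrier:
  "A \<in> carrier_mat nr nc \<Longrightarrow> mat_adjoint A \<in> carrier_mat nc nr"
  by (simp add: mat_adjoint_def mat_of_rows_def)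

lemma mat_adjoint_index:
  assumes "A \<in> carrier_mat nr nc" "i < nc" "j < nr"
  shows "mat_adjoint A $$ (i, j) = conjugate (A $$ (j, i))"
  using assms by (simp add: mat_adjoint_def mat_of_rows_def)

lemma inner_prod_mat_adjoint:
  fixes A :: "complex mat"
  assumes A: "A \<in> carrier_mat nr nc" and x: "x \<in> carrier_vec nc" and y: "y \<in> carrier_vec nr"
  shows "conjugate (A *\<^sub>v x) \<bullet> y = conjugate x \<bullet> (mat_adjoint A *\<^sub>v y)"
proof -
  have "conjugate (A *\<^sub>v x) \<bullet> y = (\<Sum>i<nr. \<Sum>j<nc. cnj (A $$ (i,j)) * cnj (x $ j) * y $ i)"
    using A x y by (simp add: scalar_prod_def sum_distrib_right atLeast0LessThan)
  also have "\<dots> = (\<Sum>j<nc. \<Sum>i<nr. cnj (A $$ (i,j)) * cnj (x $ j) * y $ i)"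
    by (rule sum.swap)
  also have "\<dots> = conjugate x \<bullet> (mat_adjoint A *\<^sub>v y)"
    using A x y mat_adjoint_carrier[OF A]
    by (simp add: scalar_prod_def sum_distrib_left mat_adjoint_index[OF A] atLeast0LessThan mult_ac)
  finally show ?thesis .
qed

lemma mat_diag_mult_vec:
  fixes d :: "nat \<Rightarrow> 'a :: semiring_0"
  assumes "x \<in> carrier_vec n"
  shows "mat_diag n d *\<^sub>v x = vec n (\<lambda>l. d l * x $ l)"
proof (rule eq_vecI)
  fix l assume "l < dim_vec (vec n (\<lambda>l. d l * x $ l))"
  with assms show "(mat_diag n d *\<^sub>v x) $ l = vec n (\<lambda>l. d l * x $ l) $ l"
    by (simp add: mat_diag_def scalar_prod_def if_distrib[of "\<lambda>t. t * _"] cong: if_cong)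
qed (simp add: mat_diag_def)

text \<open>
  \<open>conjugate F\<close> and \<open>G\<close> are the coordinates of the two arguments in the orthonormal bases given by
  the columns of \<open>U\<close> and \<open>V\<close>, in which the matrix of the form is diagonal.
\<close>

lemma sesquilinear_form_svd:
  fixes U V :: "complex mat"
  assumes U: "U \<in> carrier_mat n n" and V: "V \<in> carrier_mat n n"
    and UU: "U * mat_adjoint U = 1\<^sub>m n" and VV: "V * mat_adjoint V = 1\<^sub>m n"
    and F: "F \<in> carrier_vec n" and G: "G \<in> carrier_vec n"
  shows "conjugate (U *\<^sub>v conjugate F) \<bullet> (U * mat_diag n d * mat_adjoint V *\<^sub>v (V *\<^sub>v G))
    = (\<Sum>l<n. F $ l * (d l * G $ l))"
proof -
  note U' = mat_adjoint_carrier[OF U] and V' = mat_adjoint_carrier[OF V]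
  have D: "mat_diag n d \<in> carrier_mat n n" by simp
  \<comment> \<open>For square matrices a right inverse is also a left inverse.\<close>
  have UU': "mat_adjoint U * U = 1\<^sub>m n" and VV': "mat_adjoint V * V = 1\<^sub>m n"
    using mat_mult_left_right_inverse[OF U U' UU] mat_mult_left_right_inverse[OF V V' VV] by auto
  have "mat_adjoint V *\<^sub>v (V *\<^sub>v G) = G"
    using assoc_mult_mat_vec[OF V' V G] VV' G by simp
  then have B: "U * mat_diag n d * mat_adjoint V *\<^sub>v (V *\<^sub>v G) = U *\<^sub>v (mat_diag n d *\<^sub>v G)"
    using assoc_mult_mat_vec[OF mult_carrier_mat[OF U D] V' mult_mat_vec_carrier[OF V G]]
      assoc_mult_mat_vec[OF U D G] by simp
  have DG: "mat_diag n d *\<^sub>v G \<in> carrier_vec n"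
    using mult_mat_vec_carrier[OF D G] .
  have "conjugate (U *\<^sub>v conjugate F) \<bullet> (U *\<^sub>v (mat_diag n d *\<^sub>v G))
      = F \<bullet> (mat_adjoint U *\<^sub>v (U *\<^sub>v (mat_diag n d *\<^sub>v G)))"
    using inner_prod_mat_adjoint[OF U _ mult_mat_vec_carrier[OF U DG], of "conjugate F"] F by simp
  also have "\<dots> = F \<bullet> (mat_diag n d *\<^sub>v G)"
    using assoc_mult_mat_vec[OF U' U DG] UU' DG by simp
  also have "\<dots> = (\<Sum>l<n. F $ l * (d l * G $ l))"
    using G by (simp add: mat_diag_mult_vec scalar_prod_def atLeast0LessThan)
  finally show ?thesis using B by simp
qed

lemma weighted_average_bounds:
  fixes w s :: "'i \<Rightarrow> real"
  assumes "finite A" and w: "\<And>i. i \<in> A \<Longrightarrow> 0 \<le> w i" and pos: "0 < sum w A"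
  shows "(MIN i\<in>A. s i) \<le> (\<Sum>i\<in>A. w i * s i) / sum w A"
    and "(\<Sum>i\<in>A. w i * s i) / sum w A \<le> (MAX i\<in>A. s i)"
proof -
  have "sum w A * (MIN i\<in>A. s i) \<le> (\<Sum>i\<in>A. w i * s i)"
    unfolding sum_distrib_right using assms by (intro sum_mono mult_left_mono) auto
  then show "(MIN i\<in>A. s i) \<le> (\<Sum>i\<in>A. w i * s i) / sum w A"
    using pos by (simp add: pos_le_divide_eq mult.commute)
  have "(\<Sum>i\<in>A. w i * s i) \<le> sum w A * (MAX i\<in>A. s i)"
    unfolding sum_distrib_right using assms by (intro sum_mono mult_left_mono) auto
  then show "(\<Sum>i\<in>A. w i * s i) / sum w A \<le> (MAX i\<in>A. s i)"
    using pos by (simp add: pos_divide_le_eq mult.commute)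
qed

lemma Reals_eq_cmod_mult_sgn:
  assumes "z \<in> \<real>"
  shows "z = complex_of_real (cmod z * sgn (Re z))"
  using assms by (elim Reals_cases) (simp flip: abs_mult_sgn add: sgn_if)

theorem theorem2p2:
  fixes n :: nat
    and B U V :: "complex mat"
    and \<sigma> f g F G :: "complex vec"
    and \<theta> :: "nat \<Rightarrow> real"
  assumes "B \<in> carrier_mat n n"
    and "U \<in> carrier_mat n n"
    and "V \<in> carrier_mat n n"
    and "\<sigma> \<in> carrier_vec n"
    and "B = U * mat_diag n (\<lambda>l. \<sigma> $ l) * mat_adjoint V"
    and "U * mat_adjoint U = 1\<^sub>m n"
    and "V * mat_adjoint V = 1\<^sub>m n"
    and "\<forall>l<n. \<theta> l \<in> {0, pi}"
    and "\<forall>l<n. \<sigma> $ l = complex_of_real (cmod (\<sigma> $ l)) * exp (\<i> * complex_of_real (\<theta> l))"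
    and "f \<in> carrier_vec n"
    and "g \<in> carrier_vec n"
    and "F \<in> carrier_vec n"
    and "G \<in> carrier_vec n"
    and "hadamard_vec F G \<noteq> 0\<^sub>v n"
    and "f = U *\<^sub>v conjugate F"
    and "g = V *\<^sub>v G"
    and "\<forall>l<n. F $ l * G $ l * exp (\<i> * complex_of_real (\<theta> l)) \<in> \<real>"
  shows "(conjugate f \<bullet> (B *\<^sub>v g)) / complex_of_real (\<Sum>l<n. cmod (F $ l * G $ l)) \<in> \<real>
    \<and> (MIN l\<in>{..<n}. cmod (\<sigma> $ l) * sgn (Re (F $ l * G $ l * exp (\<i> * complex_of_real (\<theta> l)))))
        \<le> Re ((conjugate f \<bullet> (B *\<^sub>v g)) / complex_of_real (\<Sum>l<n. cmod (F $ l * G $ l)))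
    \<and> Re ((conjugate f \<bullet> (B *\<^sub>v g)) / complex_of_real (\<Sum>l<n. cmod (F $ l * G $ l)))
        \<le> (MAX l\<in>{..<n}. cmod (\<sigma> $ l) * sgn (Re (F $ l * G $ l * exp (\<i> * complex_of_real (\<theta> l)))))"
proof -
  note F = assms(12) and G = assms(13)
  define w where "w l = cmod (F $ l * G $ l)" for l
  define s where "s l = cmod (\<sigma> $ l) * sgn (Re (F $ l * G $ l * exp (\<i> * complex_of_real (\<theta> l))))"
    for l
  have summand: "F $ l * (\<sigma> $ l * G $ l) = complex_of_real (w l * s l)" if "l < n" for l
  proof -
    let ?z = "F $ l * G $ l * exp (\<i> * complex_of_real (\<theta> l))"
    have "F $ l * (\<sigma> $ l * G $ l) = complex_of_real (cmod (\<sigma> $ l)) * ?z"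
      using assms(9) that by (metis mult.assoc mult.commute)
    also have "?z = complex_of_real (cmod ?z * sgn (Re ?z))"
      using assms(17) that by (intro Reals_eq_cmod_mult_sgn) blast
    \<comment> \<open>The phase has modulus one.\<close>
    also have "cmod ?z = w l"
      by (simp add: w_def norm_mult)
    finally show ?thesis
      by (simp add: s_def mult_ac)
  qed
  have form: "conjugate f \<bullet> (B *\<^sub>v g) = complex_of_real (\<Sum>l<n. w l * s l)"
    unfolding assms(5,15,16) sesquilinear_form_svd[OF assms(2,3,6,7) F G]
    by (simp add: summand)
  then have quotient: "conjugate f \<bullet> (B *\<^sub>v g) / complex_of_real (\<Sum>l<n. w l)
      = complex_of_real ((\<Sum>l<n. w l * s l) / (\<Sum>l<n. w l))"
    by simp
  obtain k where "k < n" "F $ k * G $ k \<noteq> 0"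
    using assms(14) F by (auto simp: hadamard_vec_def vec_eq_iff)
  then have "0 < sum w {..<n}"
    by (intro sum_pos2[of _ k]) (auto simp: w_def)
  then have "(MIN l\<in>{..<n}. s l) \<le> (\<Sum>l<n. w l * s l) / sum w {..<n}"
    and "(\<Sum>l<n. w l * s l) / sum w {..<n} \<le> (MAX l\<in>{..<n}. s l)"
    by (intro weighted_average_bounds; simp add: w_def)+
  then show ?thesis
    unfolding w_def[symmetric] s_def[symmetric] quotient Re_complex_of_real by simp
qed

end
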